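(* Let $I$ be a directed poset, $(\Omega,\mathcal F,(\mathcal F_i)_{i\in I},\mathbb P)$ a filtered probability space, and $r>0$ a real number. Let $(X_i)_{i\in I}$ be a martingale such that for all $i\in I$, $$\mathbb P(X_i\le r)=1.$$ Then there exists a unique $X\in\mathrm{RV}_r(\mathbf\Omega)$ such that for all $i\in I$, $$\mathbb E[X\mid f_i]=X_i.$$
   Context: A filtered probability space is a probability space $\mathbf\Omega=(\Omega,\mathcal F,\mathbb P)$ with sub-$\sigma$-algebras $\mathcal F_i\subseteq\mathcal F$ ($i\in I$) such that $\mathcal F_i\subseteq\mathcal F_j$ for $i\le j$ and $\sigma(\bigcup_{i\in I}\mathcal F_i)=\mathcal F$. Write $\mathbf\Omega_i=(\Omega,\mathcal F_i,\mathbb P|_{\mathcal F_i})$. The identity of $\Omega$ gives measure-preserving maps $f_{ij}:\mathbf\Omega_j\to\mathbf\Omega_i$ ($i\le j$) and $f_i:\mathbf\Omega\to\mathbf\Omega_i$. For a probability space $\mathbf\Omega$, $\mathrm{RV}(\mathbf\Omega)$ is the set of (integrable) measurable functions $\Omega\to[0,\infty)$ modulo $\mathbb P$-a.s. equality, and $\mathrm{RV}_r(\mathbf\Omega)$ is the subset of those $f$ with $\mathbb P(f\le r)=1$. For a measure-preserving map $g:\mathbf\Omega_1\to\mathbf\Omega_2$ and $f\in\mathrm{RV}(\mathbf\Omega_1)$, $\mathbb E[f\mid g]$ is the unique element of $\mathrm{RV}(\mathbf\Omega_2)$ with $\int_{g^{-1}(B)}f\,\mathrm d\mathbb P_1=\int_B\mathbb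 E[f\mid g]\,\mathrm d\mathbb P_2$ for all measurable $B\subseteq\Omega_2$. A martingale is a family $(X_i)_{i\in I}$ with $X_i\in\mathrm{RV}(\mathbf\Omega_i)$ and $\mathbb E[X_j\mid f_{ij}]=X_i$ for all $i\le j$. *)

theory Defs
  imports "HOL-Probability.Probability"
begin

definition RV_fun :: "'a measure \<Rightarrow> ('a \<Rightarrow> real) set" where
  "RV_fun M = {f. f \<in> borel_measurable M \<and> (\<forall>x\<in>space M. 0 \<le> f x) \<and> integrable M f}"

definition AE_eq_rel :: "'a measure \<Rightarrow> (('a \<Rightarrow> real) \<times> ('a \<Rightarrow> real)) set" where
  "AE_eq_rel M = {(f, g). f \<in> RV_fun M \<and> g \<in> RV_fun M \<and> (AE x in M. f x = g x)}"

text \<open>Functions are total on the type \<open>'a\<close>; their values outside \<open>space M\<close> are unconstrained and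
  are identified away by \<open>AE_eq_rel M\<close>.\<close>

definition RV :: "'a measure \<Rightarrow> ('a \<Rightarrow> real) set set" where
  "RV M = RV_fun M // AE_eq_rel M"

text \<open>The probability of \<open>{f \<le> r}\<close> does not depend on the representative \<open>f\<close> of a class, so here
  and below a property of a class is stated for all of its representatives.\<close>

definition RV_le :: "real \<Rightarrow> 'a measure \<Rightarrow> ('a \<Rightarrow> real) set set" where
  "RV_le r M = {X \<in> RV M. \<forall>f\<in>X. measure M {x \<in> space M. f x \<le> r} = 1}"

text \<open>\<open>cond_exp_map M N g X\<close> is the conditional expectation of the class \<open>X \<in> RV M\<close> given the map
  \<open>g\<close>. Existence and uniqueness, hence the meaning of the definite description, rely on
  \<open>g\<close> being measure preserving from \<open>M\<close> to \<open>N\<close>.\<close>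

definition cond_exp_map ::
  "'a measure \<Rightarrow> 'b measure \<Rightarrow> ('a \<Rightarrow> 'b) \<Rightarrow> ('a \<Rightarrow> real) set \<Rightarrow> ('b \<Rightarrow> real) set" where
  "cond_exp_map M N g X = (THE Y. Y \<in> RV N \<and>
     (\<forall>f\<in>X. \<forall>h\<in>Y. \<forall>B\<in>sets N.
        (LINT x:g -` B \<inter> space M|M. f x) = (LINT y:B|N. h y)))"

definition directed_on :: "'i::order set \<Rightarrow> bool" where
  "directed_on I \<longleftrightarrow> I \<noteq> {} \<and> (\<forall>i\<in>I. \<forall>j\<in>I. \<exists>k\<in>I. i \<le> k \<and> j \<le> k)"

text \<open>The measures \<open>F i\<close> only serve to carry \<open>\<sigma>\<close>-algebras (as in \<open>subalgebra\<close>); the probability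
  space with \<open>\<sigma>\<close>-algebra \<open>sets (F i)\<close> and the restriction of \<open>M\<close> is \<open>restr_to_subalg M (F i)\<close>.\<close>

locale filtered_prob_space = prob_space M
  for M :: "'a measure" +
  fixes I :: "'i::order set" and F :: "'i \<Rightarrow> 'a measure"
  assumes subalg: "\<And>i. i \<in> I \<Longrightarrow> subalgebra M (F i)"
    and mono: "\<And>i j. i \<in> I \<Longrightarrow> j \<in> I \<Longrightarrow> i \<le> j \<Longrightarrow> sets (F i) \<subseteq> sets (F j)"
    and generates: "sigma_sets (space M) (\<Union>i\<in>I. sets (F i)) = sets M"

definition martingale ::
  "'a measure \<Rightarrow> 'i::order set \<Rightarrow> ('i \<Rightarrow> 'a measure) \<Rightarrow> ('i \<Rightarrow> ('a \<Rightarrow> real) set) \<Rightarrow> bool" where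
  "martingale M I F X \<longleftrightarrow>
     (\<forall>i\<in>I. X i \<in> RV (restr_to_subalg M (F i))) \<and>
     (\<forall>i\<in>I. \<forall>j\<in>I. i \<le> j \<longrightarrow>
        cond_exp_map (restr_to_subalg M (F j)) (restr_to_subalg M (F i)) id (X j) = X i)"

end

theory Submission
  imports Defs
begin

text \<open>
  A bounded martingale \<open>(X\<^sub>i)\<close> over a directed poset is a single set function in disguise. For
  \<open>B\<close> in the algebra \<open>\<A> = \<Union>\<^sub>i \<F>\<^sub>i\<close> put \<open>\<nu> B = \<integral>\<^sub>B X\<^sub>i\<close> for any \<open>i\<close> with \<open>B \<in> \<F>\<^sub>i\<close>. The martingale
  property and directedness make \<open>\<nu>\<close> independent of the choice of \<open>i\<close>, and directedness makes it
  finitely additive. A class \<open>Y\<close> satisfies \<open>E[Y | \<F>\<^sub>i] = X\<^sub>i\<close> for all \<open>i\<close> exactly if it integrates to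
  \<open>\<nu> B\<close> over every \<open>B \<in> \<A>\<close>, so the required \<open>Y\<close> is the density of \<open>\<nu>\<close> with respect to the
  probability \<open>P\<close>.

  Existence of the density (\<open>dominated_additive_set_function_has_density\<close>) comes from
  \<open>0 \<le> \<nu> \<le> r P\<close> on \<open>\<A>\<close>. The upper bound forces \<open>\<nu>\<close> to be continuous at \<open>\<emptyset>\<close>, because \<open>P\<close> is, so
  Caratheodory's theorem extends \<open>\<nu>\<close> to a measure on \<open>\<sigma>(\<A>)\<close>; the same holds for \<open>r P - \<nu>\<close>. The two
  extensions add up to \<open>r P\<close>, hence have Radon-Nikodym densities with sum \<open>r\<close>, and the density of
  \<open>\<nu>\<close> lies between \<open>0\<close> and \<open>r\<close>. No sequence in the index set is chosen, which is why the argument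
  covers uncountable directed sets.

  Uniqueness (\<open>AE_eq_if_set_integrals_eq_on_generator\<close>) holds because \<open>\<A>\<close> is closed under
  intersections and generates the \<open>\<sigma>\<close>-algebra of the whole space. The same lemma, applied to a full
  \<open>\<sigma>\<close>-algebra, shows that conditional expectations are unique; \<open>cond_exp_map_eq_iff\<close> uses this to
  turn the definite description of the conditional expectation into an equation of integrals.
\<close>

section \<open>Classes of random variables\<close>

lemma equiv_AE_eq_rel: "equiv (RV_fun M) (AE_eq_rel M)"
proof (rule equivI)
  show "AE_eq_rel M \<subseteq> RV_fun M \<times> RV_fun M" by (auto simp: AE_eq_rel_def)
  show "refl_on (RV_fun M) (AE_eq_rel M)" by (auto simp: refl_on_def AE_eq_rel_def)
  show "sym (AE_eq_rel M)" by (auto simp: sym_def AE_eq_rel_def)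
  show "trans (AE_eq_rel M)" by (auto simp: trans_def AE_eq_rel_def)
qed

lemma RV_fun_if_mem_RV:
  assumes "Y \<in> RV M" "f \<in> Y"
  shows "f \<in> RV_fun M"
proof -
  have "Y \<subseteq> RV_fun M"
    using assms(1) unfolding RV_def by (rule in_quotient_imp_subset[OF equiv_AE_eq_rel])
  with assms(2) show ?thesis by blast
qed

lemma AE_eq_if_mem_RV:
  assumes "Y \<in> RV M" "f \<in> Y" "g \<in> Y"
  shows "AE x in M. f x = g x"
  using quotient_eq_iff[OF equiv_AE_eq_rel assms(1)[unfolded RV_def] assms(1)[unfolded RV_def] assms(2,3)]
  by (simp add: AE_eq_rel_def)

lemma RV_eqI:
  assumes "Y \<in> RV M" "Z \<in> RV M" "f \<in> Y" "g \<in> Z" "AE x in M. f x = g x"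
  shows "Y = Z"
proof (rule quotient_eqI[OF equiv_AE_eq_rel assms(1,2)[unfolded RV_def] assms(3,4)])
  show "(f, g) \<in> AE_eq_rel M"
    using assms(5) RV_fun_if_mem_RV[OF assms(1,3)] RV_fun_if_mem_RV[OF assms(2,4)]
    by (simp add: AE_eq_rel_def)
qed

lemma RV_has_representative:
  assumes "Y \<in> RV M"
  obtains f where "f \<in> Y" "f \<in> RV_fun M"
proof -
  have "Y \<noteq> {}"
    using assms unfolding RV_def by (rule in_quotient_imp_non_empty[OF equiv_AE_eq_rel])
  then show thesis using RV_fun_if_mem_RV[OF assms] that by blast
qed

lemma RV_fun_has_class:
  assumes "f \<in> RV_fun M"
  obtains Y where "Y \<in> RV M" "f \<in> Y"
  using that quotientI[OF assms, of "AE_eq_rel M"] equiv_class_self[OF equiv_AE_eq_rel assms]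
  unfolding RV_def by blast

section \<open>Set integrals as measures\<close>

lemma RV_funD:
  assumes "f \<in> RV_fun M"
  shows "f \<in> borel_measurable M" "integrable M f" "\<And>x. x \<in> space M \<Longrightarrow> 0 \<le> f x"
  using assms by (auto simp: RV_fun_def)

lemma set_integrable_RV_fun:
  assumes "f \<in> RV_fun M" "B \<in> sets M"
  shows "set_integrable M B f"
  unfolding set_integrable_def by (rule integrable_mult_indicator[OF assms(2) RV_funD(2)[OF assms(1)]])

lemma (in finite_measure) const_in_RV_fun:
  assumes "0 \<le> r"
  shows "(\<lambda>x. r) \<in> RV_fun M"
  using assms by (simp add: RV_fun_def)

lemma (in finite_measure) set_integral_constant:
  fixes r :: real
  assumes "B \<in> sets M"
  shows "(LINT x:B|M. r) = r * measure M B"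
  using assms by (simp add: set_lebesgue_integral_def mult.commute)

lemma set_integral_nonneg_RV_fun:
  assumes "f \<in> RV_fun M"
  shows "0 \<le> (LINT x:B|M. f x)"
  unfolding set_lebesgue_integral_def
  using RV_funD(3)[OF assms] by (intro Bochner_Integration.integral_nonneg) (auto simp: indicator_def)

text \<open>This equation turns a statement about set integrals into one about measures, to which
  uniqueness of extensions and the Radon-Nikodym theorem apply.\<close>

lemma emeasure_density_RV_fun:
  assumes "f \<in> RV_fun M" "B \<in> sets M"
  shows "emeasure (density M (\<lambda>x. ennreal (f x))) B = ennreal (LINT x:B|M. f x)"
proof -
  note f = RV_funD[OF assms(1)]
  have "emeasure (density M (\<lambda>x. ennreal (f x))) B = (\<integral>\<^sup>+x. ennreal (indicator B x *\<^sub>R f x) \<partial>M)"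
    using f(1) assms(2) by (auto simp: emeasure_density intro!: nn_integral_cong split: split_indicator)
  also have "\<dots> = ennreal (LINT x:B|M. f x)"
    unfolding set_lebesgue_integral_def
    using f assms(2) integrable_mult_indicator[OF assms(2) f(2)]
    by (intro nn_integral_eq_integral) (auto simp: indicator_def)
  finally show ?thesis .
qed

text \<open>The measures with densities \<open>f\<close> and \<open>g\<close> agree on a generator closed under intersections, hence
  everywhere, and a density is unique up to null sets.\<close>

lemma AE_eq_if_set_integrals_eq_on_generator:
  assumes "finite_measure M" and f: "f \<in> RV_fun M" and g: "g \<in> RV_fun M"
    and E: "Int_stable E" "E \<subseteq> Pow (space M)" "space M \<in> E" "sigma_sets (space M) E = sets M"
    and eq: "\<And>B. B \<in> E \<Longrightarrow> (LINT x:B|M. f x) = (LINT x:B|M. g x)"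
  shows "AE x in M. f x = g x"
proof -
  interpret finite_measure M by fact
  have sub: "E \<subseteq> sets M" using E(4) by (metis sigma_sets_superset_generator)
  have "density M (\<lambda>x. ennreal (f x)) = density M (\<lambda>x. ennreal (g x))"
  proof (rule measure_eqI_generator_eq[OF E(1,2), where A = "\<lambda>_. space M"])
    fix B assume "B \<in> E"
    with sub eq show "emeasure (density M (\<lambda>x. ennreal (f x))) B =
      emeasure (density M (\<lambda>x. ennreal (g x))) B"
      by (auto simp: emeasure_density_RV_fun[OF f] emeasure_density_RV_fun[OF g])
  qed (use E in \<open>auto simp: emeasure_density_RV_fun[OF f]\<close>)
  then have "AE x in M. ennreal (f x) = ennreal (g x)"
    using RV_funD(1)[OF f] RV_funD(1)[OF g] by (intro density_unique) auto
  with AE_space show ?thesis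
    by eventually_elim (use RV_funD(3)[OF f] RV_funD(3)[OF g] in auto)
qed

lemma set_integral_cong_AE_RV_fun:
  assumes "f \<in> RV_fun M" "g \<in> RV_fun M" "B \<in> sets M" "AE x in M. f x = g x"
  shows "(LINT x:B|M. f x) = (LINT x:B|M. g x)"
  unfolding set_lebesgue_integral_def
  using assms RV_funD(1)[OF assms(1)] RV_funD(1)[OF assms(2)]
  by (intro integral_cong_AE) auto

text \<open>The Radon-Nikodym theorem yields densities with values in \<open>[0, \<infinity>]\<close>. If the measure they define is
  finite they are almost everywhere finite, so cutting off the value \<open>\<infinity>\<close> gives an integrable real
  function with the same measure.\<close>

lemma RV_fun_real_density:
  assumes "finite_measure (density M f)" and "finite_measure M" and f: "f \<in> borel_measurable M"
  shows "(\<lambda>x. enn2real (f x)) \<in> RV_fun M"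
    "density M (\<lambda>x. ennreal (enn2real (f x))) = density M f"
proof -
  interpret D: finite_measure "density M f" by fact
  interpret finite_measure M by fact
  have fin: "(\<integral>\<^sup>+x. f x \<partial>M) < \<infinity>"
  proof -
    have "(\<integral>\<^sup>+x. f x \<partial>M) = emeasure (density M f) (space M)"
      using f by (auto simp: emeasure_density intro!: nn_integral_cong)
    then show ?thesis using D.emeasure_finite[of "space M"] by (metis less_top infinity_ennreal_def)
  qed
  then have ae: "AE x in M. f x \<noteq> \<infinity>" using f by (intro nn_integral_PInf_AE) auto
  then have ae': "AE x in M. ennreal (enn2real (f x)) = f x"
    by eventually_elim (auto simp: less_top)
  have "(\<integral>\<^sup>+x. ennreal (enn2real (f x)) \<partial>M) = (\<integral>\<^sup>+x. f x \<partial>M)"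
    by (rule nn_integral_cong_AE[OF ae'])
  with fin have "integrable M (\<lambda>x. enn2real (f x))"
    using f by (intro integrableI_nonneg) auto
  then show "(\<lambda>x. enn2real (f x)) \<in> RV_fun M" using f by (auto simp: RV_fun_def)
  show "density M (\<lambda>x. ennreal (enn2real (f x))) = density M f"
    using f ae' by (intro density_cong) auto
qed

section \<open>Conditional expectation along a measure-preserving map\<close>

text \<open>The conditional expectation is the density of the push-forward along \<open>g\<close> of the measure
  \<open>f dM\<close>. Since \<open>g\<close> preserves measure, preimages of null sets are null sets, so this push-forward is
  absolutely continuous.\<close>

lemma cond_exp_exists:
  assumes "finite_measure M" and g: "g \<in> measurable M N" and N: "distr M N g = N" and f: "f \<in> RV_fun M"
  obtains h where "h \<in> RV_fun N"
    "\<And>B. B \<in> sets N \<Longrightarrow> (LINT x:g -` B \<inter> space M|M. f x) = (LINT y:B|N. h y)"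
proof -
  interpret finite_measure M by fact
  interpret N: finite_measure N using finite_measure_distr[OF g] N by simp
  define K where "K = distr (density M (\<lambda>x. ennreal (f x))) N g"
  have g': "g \<in> measurable (density M (\<lambda>x. ennreal (f x))) N" using g by simp
  have K: "emeasure K B = ennreal (LINT x:g -` B \<inter> space M|M. f x)" if "B \<in> sets N" for B
    using that g by (simp add: K_def emeasure_distr[OF g'] emeasure_density_RV_fun[OF f] measurable_sets)
  have "absolutely_continuous N K"
    unfolding absolutely_continuous_def
  proof
    fix B assume B: "B \<in> null_sets N"
    then have "emeasure M (g -` B \<inter> space M) = 0"
      using g N by (metis emeasure_distr null_setsD1 null_setsD2)
    then have "g -` B \<inter> space M \<in> null_sets M"
      using g B by (auto intro: measurable_sets)
    then have "g -` B \<inter> space M \<in> null_sets (density M (\<lambda>x. ennreal (f x)))"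
      using absolutely_continuousI_density[of "\<lambda>x. ennreal (f x)" M] RV_funD(1)[OF f]
      by (auto simp: absolutely_continuous_def)
    then show "B \<in> null_sets K"
      using B by (auto simp: K_def null_sets_def emeasure_distr[OF g'])
  qed
  then obtain h where h: "h \<in> borel_measurable N" "density N h = K"
    using N.Radon_Nikodym[of K] by (auto simp: K_def)
  have "finite_measure K" using K[of "space N"] by (intro finite_measureI) (auto simp: K_def)
  then have fd: "finite_measure (density N h)" by (simp add: h(2))
  show thesis
  proof (rule that[OF RV_fun_real_density(1)[OF fd N.finite_measure_axioms h(1)]])
    fix B assume B: "B \<in> sets N"
    have "ennreal (LINT y:B|N. enn2real (h y)) = emeasure K B"
      by (simp add: emeasure_density_RV_fun[OF RV_fun_real_density(1)[OF fd N.finite_measure_axioms h(1)] B, symmetric]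
          RV_fun_real_density(2)[OF fd N.finite_measure_axioms h(1)] h(2))
    then show "(LINT x:g -` B \<inter> space M|M. f x) = (LINT y:B|N. enn2real (h y))"
      using K[OF B] set_integral_nonneg_RV_fun[OF f]
        set_integral_nonneg_RV_fun[OF RV_fun_real_density(1)[OF fd N.finite_measure_axioms h(1)]]
      by simp
  qed
qed

text \<open>Existence and uniqueness of the conditional expectation justify the definite description, and
  the integrals do not depend on the representatives. Hence a candidate \<open>Z\<close> can be tested on one
  representative of each class.\<close>

lemma cond_exp_map_eq_iff:
  fixes M :: "'a measure" and N :: "'b measure"
  assumes "finite_measure M" and g: "g \<in> measurable M N" and N: "distr M N g = N"
    and Y: "Y \<in> RV M" "f \<in> Y" and Z: "Z \<in> RV N" "h \<in> Z"
  shows "cond_exp_map M N g Y = Z \<longleftrightarrow>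
    (\<forall>B\<in>sets N. (LINT x:g -` B \<inter> space M|M. f x) = (LINT y:B|N. h y))"
proof -
  interpret finite_measure M by fact
  interpret N: finite_measure N using finite_measure_distr[OF g] N by simp
  define P :: "('a \<Rightarrow> real) \<Rightarrow> ('b \<Rightarrow> real) \<Rightarrow> bool"
    where "P f h \<longleftrightarrow> (\<forall>B\<in>sets N. (LINT x:g -` B \<inter> space M|M. f x) = (LINT y:B|N. h y))" for f h
  have PP: "(\<forall>f\<in>Y. \<forall>h\<in>Z. P f h) \<longleftrightarrow> P f h" if Z: "Z \<in> RV N" "h \<in> Z" for h Z
  proof -
    have "P f' h'" if "P f h" and f': "f' \<in> Y" and h': "h' \<in> Z" for f' h'
      unfolding P_def
    proof
      fix B assume B: "B \<in> sets N"
      then have "g -` B \<inter> space M \<in> sets M" using g by (rule measurable_sets[rotated])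
      then have "(LINT x:g -` B \<inter> space M|M. f' x) = (LINT x:g -` B \<inter> space M|M. f x)"
        using Y f' by (intro set_integral_cong_AE_RV_fun AE_eq_if_mem_RV[OF Y(1)])
          (auto intro: RV_fun_if_mem_RV)
      also have "\<dots> = (LINT y:B|N. h y)" using that B by (auto simp: P_def)
      also have "\<dots> = (LINT y:B|N. h' y)"
        using Z h' B by (intro set_integral_cong_AE_RV_fun AE_eq_if_mem_RV[OF Z(1)])
          (auto intro: RV_fun_if_mem_RV)
      finally show "(LINT x:g -` B \<inter> space M|M. f' x) = (LINT y:B|N. h' y)" .
    qed
    then show ?thesis using Y Z by blast
  qed
  have unique: "Z = Z'" if "Z \<in> RV N" "Z' \<in> RV N" "h \<in> Z" "h' \<in> Z'" "P f h" "P f h'" for Z Z' h h'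
  proof (rule RV_eqI[OF that(1-4)])
    show "AE x in N. h x = h' x"
    proof (rule AE_eq_if_set_integrals_eq_on_generator[where E = "sets N", OF N.finite_measure_axioms])
      show "Int_stable (sets N)" by (auto simp: Int_stable_def)
    qed (use that sets.space_closed[of N] in \<open>auto simp: P_def sets.sigma_sets_eq intro: RV_fun_if_mem_RV\<close>)
  qed
  have cem: "cond_exp_map M N g Y = (THE Z. Z \<in> RV N \<and> (\<forall>f\<in>Y. \<forall>h\<in>Z. P f h))"
    by (simp add: cond_exp_map_def P_def)
  obtain h0 where h0: "h0 \<in> RV_fun N" "P f h0"
    using cond_exp_exists[OF finite_measure_axioms g N RV_fun_if_mem_RV[OF Y]] unfolding P_def by metis
  obtain Z0 where Z0: "Z0 \<in> RV N" "h0 \<in> Z0" using RV_fun_has_class[OF h0(1)] .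
  have "cond_exp_map M N g Y = Z0"
    unfolding cem
  proof (rule the_equality)
    show "Z0 \<in> RV N \<and> (\<forall>f\<in>Y. \<forall>h\<in>Z0. P f h)" by (simp add: Z0(1) PP[OF Z0] h0(2))
  next
    fix Z' assume Z': "Z' \<in> RV N \<and> (\<forall>f\<in>Y. \<forall>h\<in>Z'. P f h)"
    then have Z'_RV: "Z' \<in> RV N" by (rule conjunct1)
    obtain h' where h': "h' \<in> Z'" using RV_has_representative[OF Z'_RV] .
    have "P f h'" using Z' h' Y(2) by simp
    then show "Z' = Z0" by (rule unique[OF Z'_RV Z0(1) h' Z0(2) _ h0(2)])
  qed
  moreover have "P f h" if "Z0 = Z"
    using PP[OF Z0] h0(2) Y(2) Z(2) that by auto
  moreover have "Z0 = Z" if "P f h"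
    by (rule unique[OF Z0(1) Z(1) Z0(2) Z(2) h0(2) that])
  ultimately show ?thesis by (fold P_def) metis
qed

section \<open>Restricting to a sub-\<open>\<sigma>\<close>-algebra\<close>

lemma RV_fun_restr_to_subalg_iff:
  assumes "subalgebra M G"
  shows "f \<in> RV_fun (restr_to_subalg M G) \<longleftrightarrow> f \<in> RV_fun M \<and> f \<in> borel_measurable G"
proof -
  have eq: "borel_measurable (restr_to_subalg M G) = borel_measurable G"
    using assms by (intro measurable_cong_sets sets_restr_to_subalg) auto
  have "f \<in> borel_measurable M" "integrable (restr_to_subalg M G) f \<longleftrightarrow> integrable M f"
    if "f \<in> borel_measurable G"
    using measurable_from_subalg[OF assms that] integrable_from_subalg[OF assms, of f]
      integrable_in_subalg[OF assms that] by blast+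
  then show ?thesis
    unfolding RV_fun_def eq space_restr_to_subalg by blast
qed

lemma set_integral_restr_to_subalg:
  fixes f :: "'a \<Rightarrow> real"
  assumes "subalgebra M G" "f \<in> borel_measurable G" "B \<in> sets G"
  shows "(LINT x:B|restr_to_subalg M G. f x) = (LINT x:B|M. f x)"
  unfolding set_lebesgue_integral_def
  using assms by (intro integral_subalgebra2) auto

lemma distr_id_restr_to_subalg:
  assumes G: "subalgebra M G" and H: "subalgebra M H" and "sets G \<subseteq> sets H"
  shows "id \<in> measurable (restr_to_subalg M H) (restr_to_subalg M G)"
    and "distr (restr_to_subalg M H) (restr_to_subalg M G) id = restr_to_subalg M G"
proof -
  have vim: "id -` B \<inter> space M = B" if "B \<in> sets G" for B
    using sets.sets_into_space[OF that] G by (auto simp: subalgebra_def)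
  show id: "id \<in> measurable (restr_to_subalg M H) (restr_to_subalg M G)"
    using assms vim by (intro measurableI)
      (auto simp: space_restr_to_subalg sets_restr_to_subalg)
  show "distr (restr_to_subalg M H) (restr_to_subalg M G) id = restr_to_subalg M G"
    using assms vim id
    by (intro measure_eqI)
      (auto simp: emeasure_distr space_restr_to_subalg sets_restr_to_subalg emeasure_restr_to_subalg
        simp del: id_apply vimage_id)
qed

text \<open>For the identity map between two sub-\<open>\<sigma>\<close>-algebras all integrals can be taken over the ambient
  space, so that conditional expectations at different indices become comparable.\<close>

lemma cond_exp_map_restr_to_subalg_eq_iff:
  assumes "finite_measure M" and G: "subalgebra M G" and H: "subalgebra M H" and GH: "sets G \<subseteq> sets H"
    and Y: "Y \<in> RV (restr_to_subalg M H)" "f \<in> Y" and Z: "Z \<in> RV (restr_to_subalg M G)" "h \<in> Z"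
  shows "cond_exp_map (restr_to_subalg M H) (restr_to_subalg M G) id Y = Z \<longleftrightarrow>
    (\<forall>B\<in>sets G. (LINT x:B|M. f x) = (LINT x:B|M. h x))"
proof -
  have f: "f \<in> borel_measurable H" and h: "h \<in> borel_measurable G"
    using RV_fun_if_mem_RV[OF Y] RV_fun_if_mem_RV[OF Z]
    by (auto simp: RV_fun_restr_to_subalg_iff[OF G] RV_fun_restr_to_subalg_iff[OF H])
  have vim: "id -` B \<inter> space M = B" if "B \<in> sets G" for B
    using sets.sets_into_space[OF that] G by (auto simp: subalgebra_def)
  show ?thesis
    unfolding cond_exp_map_eq_iff[OF finite_measure_restr_to_subalg[OF H assms(1)]
        distr_id_restr_to_subalg[OF G H GH] Y Z] space_restr_to_subalg sets_restr_to_subalg[OF G]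
  proof (rule ball_cong[OF refl])
    fix B assume B: "B \<in> sets G"
    then have "B \<in> sets H" using GH by blast
    then show "(LINT x:id -` B \<inter> space M|restr_to_subalg M H. f x) = (LINT x:B|restr_to_subalg M G. h x)
      \<longleftrightarrow> (LINT x:B|M. f x) = (LINT x:B|M. h x)"
      by (simp only: vim[OF B] set_integral_restr_to_subalg[OF G h B] set_integral_restr_to_subalg[OF H f])
  qed
qed

text \<open>Conditioning the whole space is thereby the case \<open>H = M\<close> of the preceding lemma.\<close>

lemma restr_to_subalg_self: "restr_to_subalg M M = M"
proof -
  have M: "subalgebra M M" by (simp add: subalgebra_def)
  show ?thesis
    by (rule measure_eqI) (simp_all add: sets_restr_to_subalg[OF M] emeasure_restr_to_subalg[OF M])
qed

section \<open>Densities of dominated additive set functions\<close>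

text \<open>If \<open>B\<^sub>n\<close> decreases to the empty set, then \<open>0 \<le> \<nu> B\<^sub>n \<le> r M(B\<^sub>n)\<close> tends to \<open>0\<close>. An additive set
  function on an algebra that is continuous at the empty set in this sense is a premeasure, and
  Caratheodory's theorem extends it.\<close>

lemma (in finite_measure) dominated_additive_set_function_extends:
  fixes \<nu> :: "'a set \<Rightarrow> real"
  assumes A: "algebra (space M) A" "sigma_sets (space M) A = sets M"
    and nonneg: "\<And>B. B \<in> A \<Longrightarrow> 0 \<le> \<nu> B"
    and le: "\<And>B. B \<in> A \<Longrightarrow> \<nu> B \<le> r * measure M B"
    and add: "\<And>B C. B \<in> A \<Longrightarrow> C \<in> A \<Longrightarrow> B \<inter> C = {} \<Longrightarrow> \<nu> (B \<union> C) = \<nu> B + \<nu> C"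
  obtains N where "finite_measure N" "sets N = sets M" "\<And>B. B \<in> A \<Longrightarrow> measure N B = \<nu> B"
proof -
  interpret algebra "space M" A by fact
  have sub: "A \<subseteq> sets M" using A(2) by (metis sigma_sets_superset_generator)
  have "\<nu> {} = 0" using add[of "{}" "{}"] by simp
  then have "\<exists>\<mu>. (\<forall>B\<in>A. \<mu> B = ennreal (\<nu> B)) \<and> measure_space (space M) (sigma_sets (space M) A) \<mu>"
  proof (intro caratheodory_empty_continuous)
    show "additive A (\<lambda>B. ennreal (\<nu> B))"
      using add nonneg by (auto simp: additive_def simp flip: ennreal_plus)
    fix B :: "nat \<Rightarrow> 'a set" assume B: "range B \<subseteq> A" "decseq B" "(\<Inter>i. B i) = {}"
    have "(\<lambda>i. r * measure M (B i)) \<longlonglongrightarrow> r * measure M (\<Inter>i. B i)"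
      using B sub by (intro tendsto_mult tendsto_const finite_Lim_measure_decseq) auto
    then have lim: "(\<lambda>i. r * measure M (B i)) \<longlonglongrightarrow> 0" using B by simp
    have ev: "\<forall>\<^sub>F i in sequentially. 0 \<le> \<nu> (B i)"
      "\<forall>\<^sub>F i in sequentially. \<nu> (B i) \<le> r * measure M (B i)"
      using B(1) nonneg le by (simp_all add: range_subsetD)
    have "(\<lambda>i. \<nu> (B i)) \<longlonglongrightarrow> 0"
      by (rule tendsto_sandwich[OF ev tendsto_const lim])
    from tendsto_ennrealI[OF this] show "(\<lambda>i. ennreal (\<nu> (B i))) \<longlonglongrightarrow> 0" by simp
  qed (auto simp: positive_def)
  then obtain \<mu> where \<mu>: "\<And>B. B \<in> A \<Longrightarrow> \<mu> B = ennreal (\<nu> B)" "measure_space (space M) (sets M) \<mu>"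
    by (auto simp: A(2))
  define N where "N = measure_of (space M) (sets M) \<mu>"
  have sets: "sets N = sets M" and space: "space N = space M" by (auto simp: N_def)
  have em: "emeasure N B = \<mu> B" if "B \<in> sets M" for B
    using that \<mu>(2) unfolding N_def measure_space_def
    by (intro emeasure_measure_of_sigma) auto
  show thesis
  proof (rule that[OF _ sets])
    show "finite_measure N" using em[of "space M"] \<mu>(1)[of "space M"] top
      by (intro finite_measureI) (simp add: space)
    show "measure N B = \<nu> B" if "B \<in> A" for B
      using that em[of B] \<mu>(1)[of B] sub nonneg by (auto simp: measure_def null_sets_def)
  qed
qed

text \<open>Domination \<open>\<nu> \<le> r M\<close> is known on \<open>A\<close> only, and an inequality does not pass to the generated
  \<open>\<sigma>\<close>-algebra by a \<open>\<pi>\<close>-\<open>\<lambda>\<close> argument, whereas an equality does. Therefore the complementary set function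
  \<open>\<nu>' = r M - \<nu>\<close>, which satisfies the same hypotheses, is extended as well. The identity
  \<open>\<nu> + \<nu>' = r M\<close> then holds for the extensions; it gives absolute continuity of both and bounds their
  densities by \<open>r\<close>.\<close>

theorem (in finite_measure) dominated_additive_set_function_has_density:
  fixes \<nu> :: "'a set \<Rightarrow> real"
  assumes "0 \<le> r" and A: "algebra (space M) A" "sigma_sets (space M) A = sets M"
    and nonneg: "\<And>B. B \<in> A \<Longrightarrow> 0 \<le> \<nu> B"
    and le: "\<And>B. B \<in> A \<Longrightarrow> \<nu> B \<le> r * measure M B"
    and add: "\<And>B C. B \<in> A \<Longrightarrow> C \<in> A \<Longrightarrow> B \<inter> C = {} \<Longrightarrow> \<nu> (B \<union> C) = \<nu> B + \<nu> C"
  obtains f where "f \<in> RV_fun M" "AE x in M. f x \<le> r" "\<And>B. B \<in> A \<Longrightarrow> (LINT x:B|M. f x) = \<nu> B"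
proof -
  interpret algebra "space M" A by fact
  have sub: "A \<subseteq> sets M" using A(2) by (metis sigma_sets_superset_generator)
  define \<nu>' where "\<nu>' B = r * measure M B - \<nu> B" for B
  obtain N where N: "finite_measure N" "sets N = sets M" "\<And>B. B \<in> A \<Longrightarrow> measure N B = \<nu> B"
    by (rule dominated_additive_set_function_extends[OF A nonneg le add]) blast+
  obtain N' where N': "finite_measure N'" "sets N' = sets M" "\<And>B. B \<in> A \<Longrightarrow> measure N' B = \<nu>' B"
  proof (rule dominated_additive_set_function_extends[OF A, of \<nu>' r])
    fix B C assume BC: "B \<in> A" "C \<in> A" "B \<inter> C = {}"
    then have "B \<in> sets M" "C \<in> sets M" using sub by blast+
    then have "measure M (B \<union> C) = measure M B + measure M C"
      using BC(3) by (rule finite_measure_Union)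
    then show "\<nu>' (B \<union> C) = \<nu>' B + \<nu>' C"
      by (simp add: \<nu>'_def add[OF BC] algebra_simps)
  qed (use nonneg le in \<open>auto simp: \<nu>'_def\<close>)
  interpret N: finite_measure N by fact
  interpret N': finite_measure N' by fact
  have space: "space N = space M" "space N' = space M"
    using sets_eq_imp_space_eq[OF N(2)] sets_eq_imp_space_eq[OF N'(2)] by simp_all
  have sum: "measure N B + measure N' B = r * measure M B" if B: "B \<in> sets M" for B
  proof -
    have "Int_stable A" "A \<subseteq> Pow (space M)"
      using space_closed by (auto simp: Int_stable_def)
    moreover have "B \<in> sigma_sets (space M) A" using B A(2) by simp
    ultimately show ?thesis
    proof (induction rule: sigma_sets_induct_disjoint)
      case (basic B)
      then show ?case using N(3) N'(3) by (simp add: \<nu>'_def)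
    next
      case empty
      then show ?case by simp
    next
      case (compl B)
      have total: "measure N (space M) + measure N' (space M) = r * measure M (space M)"
        using N(3) N'(3) top by (simp add: \<nu>'_def)
      have "B \<in> sets M" using compl A(2) by simp
      then have "measure N (space M - B) = measure N (space M) - measure N B"
        "measure N' (space M - B) = measure N' (space M) - measure N' B"
        "measure M (space M - B) = measure M (space M) - measure M B"
        using N.finite_measure_compl[of B] N'.finite_measure_compl[of B] finite_measure_compl[of B]
        by (simp_all add: N(2) N'(2) space)
      with total compl show ?case by (simp add: right_diff_distrib)
    next
      case (union B)
      then have B: "range B \<subseteq> sets M" using A(2) by auto
      have "(\<lambda>i. r * measure M (B i)) sums (measure N (\<Union>i. B i) + measure N' (\<Union>i. B i))"
        using sums_add[OF N.finite_measure_UNION[of B] N'.finite_measure_UNION[of B]]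
          union B N(2) N'(2) by simp
      moreover have "(\<lambda>i. r * measure M (B i)) sums (r * measure M (\<Union>i. B i))"
        using union B by (intro sums_mult finite_measure_UNION) auto
      ultimately show ?case by (rule sums_unique2)
    qed
  qed
  have dens: "\<exists>f. f \<in> RV_fun M \<and> density M (\<lambda>x. ennreal (f x)) = K"
    if K: "finite_measure K" "sets K = sets M" and le: "\<And>B. B \<in> sets M \<Longrightarrow> measure K B \<le> r * measure M B"
    for K
  proof -
    interpret K: finite_measure K by fact
    have "absolutely_continuous M K"
      unfolding absolutely_continuous_def
    proof
      fix B assume B: "B \<in> null_sets M"
      then have "measure K B = 0"
        using le[of B] by (intro order.antisym[OF _ measure_nonneg]) (auto simp: measure_def null_sets_def)
      then show "B \<in> null_sets K" using B K(2) by (auto simp: null_sets_def K.emeasure_eq_measure)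
    qed
    then obtain f where f: "f \<in> borel_measurable M" "density M f = K"
      using Radon_Nikodym[of K] K(2) by auto
    from f(2) K(1) have fin: "finite_measure (density M f)" by simp
    show ?thesis
      using RV_fun_real_density[OF fin finite_measure_axioms f(1)] unfolding f(2) by blast
  qed
  obtain f where f: "f \<in> RV_fun M" "density M (\<lambda>x. ennreal (f x)) = N"
  proof -
    have "measure N B \<le> r * measure M B" if "B \<in> sets M" for B
      using sum[OF that] measure_nonneg[of N' B] by linarith
    from dens[OF N(1,2) this] that show thesis by blast
  qed
  obtain f' where f': "f' \<in> RV_fun M" "density M (\<lambda>x. ennreal (f' x)) = N'"
  proof -
    have "measure N' B \<le> r * measure M B" if "B \<in> sets M" for B
      using sum[OF that] measure_nonneg[of N B] by linarith
    from dens[OF N'(1,2) this] that show thesis by blast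
  qed
  have int: "(LINT x:B|M. f x) = measure N B" "(LINT x:B|M. f' x) = measure N' B" if "B \<in> sets M" for B
    using emeasure_density_RV_fun[OF f(1) that] emeasure_density_RV_fun[OF f'(1) that]
      set_integral_nonneg_RV_fun[OF f(1), of B] set_integral_nonneg_RV_fun[OF f'(1), of B]
    by (auto simp: f f' N.emeasure_eq_measure N'.emeasure_eq_measure)
  have "AE x in M. f x + f' x = r"
  proof (rule AE_eq_if_set_integrals_eq_on_generator[where E = "sets M", OF finite_measure_axioms])
    show "(\<lambda>x. f x + f' x) \<in> RV_fun M" using f(1) f'(1) by (auto simp: RV_fun_def)
    show "(\<lambda>x. r) \<in> RV_fun M" using assms(1) by (rule const_in_RV_fun)
    fix B assume B: "B \<in> sets M"
    have "set_integrable M B f" "set_integrable M B f'"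
      using f(1) f'(1) B by (auto intro: set_integrable_RV_fun)
    then show "(LINT x:B|M. f x + f' x) = (LINT x:B|M. r)"
      using int[OF B] sum[OF B] by (simp add: set_integral_constant[OF B])
  qed (use sets.space_closed[of M] in \<open>auto simp: Int_stable_def sets.sigma_sets_eq\<close>)
  then have "AE x in M. f x \<le> r"
    using AE_space by eventually_elim (use RV_funD(3)[OF f'(1)] in force)
  moreover have "(LINT x:B|M. f x) = \<nu> B" if "B \<in> A" for B using that int(1) N(3) sub by auto
  ultimately show thesis using f(1) that by blast
qed

section \<open>The convergence theorem\<close>

lemma algebra_directed_union:
  assumes "directed_on I" and "\<And>i. i \<in> I \<Longrightarrow> algebra \<Omega> (A i)"
    and mono: "\<And>i j. i \<in> I \<Longrightarrow> j \<in> I \<Longrightarrow> i \<le> j \<Longrightarrow> A i \<subseteq> A j"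
  shows "algebra \<Omega> (\<Union>i\<in>I. A i)"
proof -
  have alg: "A i \<subseteq> Pow \<Omega>" "{} \<in> A i" "\<And>B. B \<in> A i \<Longrightarrow> \<Omega> - B \<in> A i"
    "\<And>B C. B \<in> A i \<Longrightarrow> C \<in> A i \<Longrightarrow> B \<union> C \<in> A i" if "i \<in> I" for i
    using assms(2)[OF that] by (auto simp: algebra_iff_Un)
  have un: "B \<union> C \<in> (\<Union>i\<in>I. A i)" if B: "i \<in> I" "B \<in> A i" and C: "j \<in> I" "C \<in> A j" for i j B C
  proof -
    obtain k where "k \<in> I" "i \<le> k" "j \<le> k" using assms(1) B C unfolding directed_on_def by blast
    with alg(4)[of k B C] mono[of i k] mono[of j k] B C show ?thesis by blast
  qed
  show ?thesis
    unfolding algebra_iff_Un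
  proof (intro conjI ballI)
    show "(\<Union>i\<in>I. A i) \<subseteq> Pow \<Omega>" using alg(1) by (rule UN_least)
    show "{} \<in> (\<Union>i\<in>I. A i)" using alg(2) assms(1) unfolding directed_on_def by blast
  next
    fix B assume "B \<in> (\<Union>i\<in>I. A i)"
    then show "\<Omega> - B \<in> (\<Union>i\<in>I. A i)" using alg(3) by (elim UN_E) (rule UN_I)
  next
    fix B C assume "B \<in> (\<Union>i\<in>I. A i)" "C \<in> (\<Union>i\<in>I. A i)"
    then show "B \<union> C \<in> (\<Union>i\<in>I. A i)" by (elim UN_E) (rule un)
  qed
qed

lemma (in prob_space) prob_le_eq_1_iff:
  assumes "f \<in> RV_fun M"
  shows "measure M {x \<in> space M. f x \<le> r} = 1 \<longleftrightarrow> (AE x in M. f x \<le> r)"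
  using RV_funD(1)[OF assms] by (intro prob_Collect_eq_1) auto

theorem theorem3p17:
  fixes M :: "'a measure" and I :: "'i::order set" and F :: "'i \<Rightarrow> 'a measure"
    and r :: real and X :: "'i \<Rightarrow> ('a \<Rightarrow> real) set"
  assumes "directed_on I"
    and "filtered_prob_space M I F"
    and "r > 0"
    and "martingale M I F X"
    and "\<And>i f. i \<in> I \<Longrightarrow> f \<in> X i \<Longrightarrow> measure M {x \<in> space M. f x \<le> r} = 1"
  shows "\<exists>!Y. Y \<in> RV_le r M \<and>
    (\<forall>i\<in>I. cond_exp_map M (restr_to_subalg M (F i)) id Y = X i)"
proof -
  interpret filtered_prob_space M I F by fact
  define A where "A = (\<Union>i\<in>I. sets (F i))"
  have space: "space (F i) = space M" if "i \<in> I" for i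
    using subalg[OF that] by (simp add: subalgebra_def)
  have XRV: "X i \<in> RV (restr_to_subalg M (F i))" if "i \<in> I" for i
    using assms(4) that by (simp add: martingale_def)
  have "\<exists>f. f \<in> X i" if "i \<in> I" for i
    using RV_has_representative[OF XRV[OF that]] by blast
  then obtain h where h: "\<And>i. i \<in> I \<Longrightarrow> h i \<in> X i" by metis
  have hRV: "h i \<in> RV_fun M" if "i \<in> I" for i
    using RV_fun_if_mem_RV[OF XRV[OF that] h[OF that]] RV_fun_restr_to_subalg_iff[OF subalg[OF that]]
    by blast
  have h_mart: "(LINT x:B|M. h j x) = (LINT x:B|M. h i x)"
    if "i \<in> I" "j \<in> I" "i \<le> j" "B \<in> sets (F i)" for i j B
  proof -
    have "cond_exp_map (restr_to_subalg M (F j)) (restr_to_subalg M (F i)) id (X j) = X i"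
      using assms(4) that by (simp add: martingale_def)
    then show ?thesis
      using that cond_exp_map_restr_to_subalg_eq_iff[OF finite_measure_axioms subalg subalg mono XRV h XRV h,
          of i j] by blast
  qed
  have ce_iff: "cond_exp_map M (restr_to_subalg M (F i)) id Y = X i \<longleftrightarrow>
    (\<forall>B\<in>sets (F i). (LINT x:B|M. f x) = (LINT x:B|M. h i x))" if "i \<in> I" "Y \<in> RV M" "f \<in> Y" for i Y f
    using cond_exp_map_restr_to_subalg_eq_iff[OF finite_measure_axioms subalg[OF that(1)], of M Y f "X i" "h i"]
      subalg[OF that(1)] that XRV h by (simp add: subalgebra_def restr_to_subalg_self)
  have algA: "algebra (space M) A"
    unfolding A_def
  proof (rule algebra_directed_union[OF assms(1)])
    show "algebra (space M) (sets (F i))" if "i \<in> I" for i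
      using sets.algebra_axioms[of "F i"] space[OF that] by simp
  qed (rule mono)
  have sigA: "sigma_sets (space M) A = sets M" using generates by (simp add: A_def)
  interpret A: algebra "space M" A by fact
  have subA: "A \<subseteq> sets M" using sigA by (metis sigma_sets_superset_generator)

  \<comment> \<open>The common value of the integrals over \<open>B\<close>; the next step shows that the chosen index is
    immaterial.\<close>
  define \<nu> where "\<nu> B = (LINT x:B|M. h (SOME i. i \<in> I \<and> B \<in> sets (F i)) x)" for B
  have \<nu>: "\<nu> B = (LINT x:B|M. h i x)" if i: "i \<in> I" "B \<in> sets (F i)" for B i
  proof -
    define j where "j = (SOME i. i \<in> I \<and> B \<in> sets (F i))"
    have j: "j \<in> I" "B \<in> sets (F j)"
      using someI[of "\<lambda>i. i \<in> I \<and> B \<in> sets (F i)" i] i by (auto simp: j_def)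
    obtain k where "k \<in> I" "i \<le> k" "j \<le> k" using assms(1) i j unfolding directed_on_def by blast
    then show ?thesis
      using h_mart[of i k B] h_mart[of j k B] i j by (simp add: \<nu>_def j_def[symmetric])
  qed
  obtain f where f: "f \<in> RV_fun M" "AE x in M. f x \<le> r" "\<And>B. B \<in> A \<Longrightarrow> (LINT x:B|M. f x) = \<nu> B"
  proof (rule dominated_additive_set_function_has_density[OF _ algA sigA, of r \<nu>])
    show "0 \<le> r" using assms(3) by simp
  next
    fix B assume B: "B \<in> A"
    then obtain i where i: "i \<in> I" "B \<in> sets (F i)" by (auto simp: A_def)
    show "0 \<le> \<nu> B" using \<nu>[OF i] set_integral_nonneg_RV_fun[OF hRV[OF i(1)]] by simp
    have hr: "AE x in M. h i x \<le> r"
      using assms(5)[OF i(1) h[OF i(1)]] prob_le_eq_1_iff[OF hRV[OF i(1)]] by simp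
    have BM: "B \<in> sets M" using B subA by auto
    have "(LINT x:B|M. h i x) \<le> (LINT x:B|M. r)"
    proof (rule set_integral_mono_AE)
      show "set_integrable M B (h i)" "set_integrable M B (\<lambda>x. r)"
        using hRV[OF i(1)] BM const_in_RV_fun[of r] assms(3) by (auto intro: set_integrable_RV_fun)
    qed (use hr in auto)
    then show "\<nu> B \<le> r * measure M B"
      by (simp add: \<nu>[OF i] set_integral_constant[OF BM])
  next
    fix B C assume BC: "B \<in> A" "C \<in> A" "B \<inter> C = {}"
    then obtain i j where ij: "i \<in> I" "B \<in> sets (F i)" "j \<in> I" "C \<in> sets (F j)" by (auto simp: A_def)
    obtain k where k: "k \<in> I" "i \<le> k" "j \<le> k" using assms(1) ij unfolding directed_on_def by blast
    have BCk: "B \<in> sets (F k)" "C \<in> sets (F k)" using ij k mono by blast+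
    have "set_integrable M B (h k)" "set_integrable M C (h k)"
      using hRV[OF k(1)] BC(1,2) subA by (auto intro: set_integrable_RV_fun)
    then have "(LINT x:B \<union> C|M. h k x) = (LINT x:B|M. h k x) + (LINT x:C|M. h k x)"
      using BC(3) by (intro set_integral_Un)
    then show "\<nu> (B \<union> C) = \<nu> B + \<nu> C" using \<nu>[OF k(1)] BCk by auto
  qed blast
  obtain Y where Y: "Y \<in> RV M" "f \<in> Y" using RV_fun_has_class[OF f(1)] .
  show ?thesis
  proof (rule ex1I[of _ Y])
    have "measure M {x \<in> space M. g x \<le> r} = 1" if g: "g \<in> Y" for g
    proof -
      have "AE x in M. g x \<le> r"
        using f(2) AE_eq_if_mem_RV[OF Y(1) g Y(2)] by eventually_elim simp
      then show ?thesis using prob_le_eq_1_iff[OF RV_fun_if_mem_RV[OF Y(1) g]] by simp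
    qed
    then have "Y \<in> RV_le r M" using Y by (simp add: RV_le_def)
    moreover have "cond_exp_map M (restr_to_subalg M (F i)) id Y = X i" if "i \<in> I" for i
    proof -
      have "(LINT x:B|M. f x) = (LINT x:B|M. h i x)" if "B \<in> sets (F i)" for B
      proof -
        have "B \<in> A" using that \<open>i \<in> I\<close> by (auto simp: A_def)
        then show ?thesis using f(3) \<nu>[OF \<open>i \<in> I\<close> that] by simp
      qed
      then show ?thesis by (simp add: ce_iff[OF \<open>i \<in> I\<close> Y])
    qed
    ultimately show "Y \<in> RV_le r M \<and> (\<forall>i\<in>I. cond_exp_map M (restr_to_subalg M (F i)) id Y = X i)"
      by blast
  next
    fix Z assume Z: "Z \<in> RV_le r M \<and> (\<forall>i\<in>I. cond_exp_map M (restr_to_subalg M (F i)) id Z = X i)"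
    then have ZRV: "Z \<in> RV M" by (simp add: RV_le_def)
    then obtain g where g: "g \<in> Z" "g \<in> RV_fun M" using RV_has_representative by blast
    have "AE x in M. g x = f x"
    proof (rule AE_eq_if_set_integrals_eq_on_generator[OF finite_measure_axioms g(2) f(1) _ _ _ sigA])
      fix B assume B: "B \<in> A"
      then obtain i where i: "i \<in> I" "B \<in> sets (F i)" by (auto simp: A_def)
      then show "(LINT x:B|M. g x) = (LINT x:B|M. f x)"
        using ce_iff[OF i(1) ZRV g(1)] Z f(3)[OF B] \<nu>[OF i] by auto
    qed (use A.space_closed in \<open>auto simp: Int_stable_def\<close>)
    then show "Z = Y" by (rule RV_eqI[OF ZRV Y(1) g(1) Y(2)])
  qed
qed

end
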